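(* Let $k\in\mathbb{Z}\setminus\{0\}$ and consider the oscillatory integral $I_{\varrho_k}:H^1_0([0,1])\to\mathbb{C}$, $I_{\varrho_k}(f)=\int_0^1 f(x)e^{-2\pi i kx}\,dx$. Then the initial error is $$e_0=\sup_{f\in H^1_0([0,1]),\ \|f\|\le1}|I_{\varrho_k}(f)|=\frac{1}{2\pi|k|}.$$ Moreover, the maximum is attained at $f^*\in H^1_0([0,1])$ given by $$f^*(t)=\frac{1}{2\pi|k|}\left(e^{2\pi i kt}-1\right),$$ i.e. $I_{\varrho_k}(f^* )=e_0$, $\|f^*\|=1$ and $f^*(0)=f^*(1)=0$.
   Context: $H^1_0([0,1])$ is the space of all absolutely continuous $f:[0,1]\to\mathbb{C}$ with $f'\in L_2([0,1])$ and $f(0)=f(1)=0$, with norm $\|f\|:=\|f'\|_{L_2}$. *)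

theory Defs
  imports "HOL-Analysis.Analysis"
begin

text \<open>
  The epsilon-delta definition of absolute continuity. A finite family of non-overlapping
  subintervals is a division \<open>D\<close> of its union; a member is \<open>{u..v}\<close> with
  \<open>u = Inf K\<close> and \<open>v = Sup K\<close>.
\<close>

definition abs_continuous_on_interval ::
    "real \<Rightarrow> real \<Rightarrow> (real \<Rightarrow> 'a::real_normed_vector) \<Rightarrow> bool" where
  "abs_continuous_on_interval a b f \<longleftrightarrow>
     (\<forall>\<epsilon>>0. \<exists>\<delta>>0. \<forall>D. D division_of \<Union>D \<longrightarrow> \<Union>D \<subseteq> {a..b} \<longrightarrow>
        (\<Sum>K\<in>D. Sup K - Inf K) < \<delta> \<longrightarrow> (\<Sum>K\<in>D. norm (f (Sup K) - f (Inf K))) < \<epsilon>)"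

definition L2_unit :: "(real \<Rightarrow> complex) set" where
  "L2_unit = {g \<in> borel_measurable (lebesgue_on {0..1}).
                integrable (lebesgue_on {0..1}) (\<lambda>x. (norm (g x))\<^sup>2)}"

definition L2_unit_norm :: "(real \<Rightarrow> complex) \<Rightarrow> real" where
  "L2_unit_norm g = sqrt (LINT x|lebesgue_on {0..1}. (norm (g x))\<^sup>2)"

definition deriv_unit :: "(real \<Rightarrow> complex) \<Rightarrow> real \<Rightarrow> complex" where
  "deriv_unit f x = vector_derivative f (at x within {0..1})"

text \<open>
  Functions on the unit interval are total functions of which only the values on \<open>{0..1}\<close>
  matter. Since \<^const>\<open>vector_derivative\<close> is total, the requirement that the derivative lies
  in \<open>L2\<close> includes that it exists almost everywhere (for absolutely continuous functions
  this is automatic by Lebesgue's theorem, so the clause does not shrink the space).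
\<close>

definition H10 :: "(real \<Rightarrow> complex) set" where
  "H10 = {f. abs_continuous_on_interval 0 1 f \<and>
             (AE x in lebesgue_on {0..1}. f differentiable (at x within {0..1})) \<and>
             deriv_unit f \<in> L2_unit \<and> f 0 = 0 \<and> f 1 = 0}"

definition H10_norm :: "(real \<Rightarrow> complex) \<Rightarrow> real" where
  "H10_norm f = L2_unit_norm (deriv_unit f)"

definition weighted_integral :: "(real \<Rightarrow> complex) \<Rightarrow> (real \<Rightarrow> complex) \<Rightarrow> complex" where
  "weighted_integral \<rho> f = (LINT x|lebesgue_on {0..1}. f x * \<rho> x)"

definition osc_weight :: "int \<Rightarrow> real \<Rightarrow> complex" where
  "osc_weight k x = exp (- 2 * of_real pi * \<i> * of_int k * of_real x)"

text \<open>
  The set of values \<open>|I(f)|\<close> over the unit ball. The supremum of a set of reals is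
  meaningful only if the set is nonempty and bounded above.
\<close>

definition unit_ball_errors :: "((real \<Rightarrow> complex) \<Rightarrow> complex) \<Rightarrow> real set" where
  "unit_ball_errors I = {cmod (I f) | f. f \<in> H10 \<and> H10_norm f \<le> 1}"

definition initial_error :: "((real \<Rightarrow> complex) \<Rightarrow> complex) \<Rightarrow> real" where
  "initial_error I = Sup (unit_ball_errors I)"

definition extremal_fun :: "int \<Rightarrow> real \<Rightarrow> complex" where
  "extremal_fun k t =
     of_real (1 / (2 * pi * \<bar>of_int k\<bar>)) * (exp (2 * of_real pi * \<i> * of_int k * of_real t) - 1)"

end

theory Submission
  imports Defs
begin

text \<open>
  The product \<open>f \<cdot> \<rho>\<^sub>k\<close> is absolutely continuous and vanishes at both endpoints, so its
  derivative integrates to \<open>0\<close>, that is \<open>2 \<pi> \<i> k I(f) = \<integral> f' \<rho>\<^sub>k\<close>. As \<open>|\<rho>\<^sub>k| = 1\<close>, the right-hand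
  side is at most \<open>\<integral> |f'|\<close>, which is at most \<open>1\<close> on the unit ball. Equality holds when \<open>f'\<close> is a
  unimodular multiple of the conjugate of \<open>\<rho>\<^sub>k\<close>, and integrating this choice gives \<open>f\<^sup>*\<close>.
\<close>

section \<open>The fundamental theorem of calculus for absolutely continuous functions\<close>

lemma abs_continuousE:
  assumes "abs_continuous_on_interval a b f" "\<epsilon> > 0"
  obtains \<delta> where "\<delta> > 0"
    "\<And>D. \<lbrakk>D division_of \<Union>D; \<Union>D \<subseteq> {a..b}; (\<Sum>K\<in>D. Sup K - Inf K) < \<delta>\<rbrakk>
      \<Longrightarrow> (\<Sum>K\<in>D. norm (f (Sup K) - f (Inf K))) < \<epsilon>"
  using assms unfolding abs_continuous_on_interval_def by meson

text \<open>
  Tags outside \<open>N\<close> are controlled by the derivative as in the classical proof. The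
  intervals tagged in \<open>N\<close> lie in a small open neighbourhood of \<open>N\<close>, so absolute continuity
  bounds the increments of \<open>f\<close> over them.
\<close>

lemma has_integral_abs_continuous:
  fixes f :: "real \<Rightarrow> 'a::banach"
  assumes "a \<le> b" and ac: "abs_continuous_on_interval a b f" and N: "negligible N"
    and vecd: "\<And>x. x \<in> {a..b} - N \<Longrightarrow> (f has_vector_derivative f' x) (at x within {a..b})"
  shows "(f' has_integral (f b - f a)) {a..b}"
proof -
  \<comment> \<open>The values of \<open>f'\<close> on \<open>N\<close> are arbitrary. Setting them
    to zero removes the terms tagged in \<open>N\<close> from the Riemann sum, and negligibility of
    \<open>N\<close> restores \<open>f'\<close> at the end.\<close>
  define g where "g x = (if x \<in> N then 0 else f' x)" for x
  have "(g has_integral (f b - f a)) {a..b}"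
    unfolding has_integral_real
  proof (intro allI impI)
    fix \<epsilon> :: real assume "\<epsilon> > 0"
    \<comment> \<open>The budget is \<open>e * (b - a)\<close> for tags outside \<open>N\<close>
      plus \<open>e\<close> for tags in \<open>N\<close>. The summand \<open>1\<close> also keeps
      the denominator positive when \<open>a = b\<close>.\<close>
    define e where "e = \<epsilon> / (b - a + 1)"
    have "e > 0" and "e * (b - a + 1) = \<epsilon>"
      using \<open>\<epsilon> > 0\<close> \<open>a \<le> b\<close> by (auto simp: e_def)
    then have e: "e * (b - a) + e = \<epsilon>"
      by (simp add: distrib_left)
    obtain \<delta> where "\<delta> > 0" and \<delta>: "\<And>D. \<lbrakk>D division_of \<Union>D; \<Union>D \<subseteq> {a..b}; (\<Sum>K\<in>D. Sup K - Inf K) < \<delta>\<rbrakk>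
          \<Longrightarrow> (\<Sum>K\<in>D. norm (f (Sup K) - f (Inf K))) < e"
      using abs_continuousE[OF ac \<open>e > 0\<close>] by blast
    \<comment> \<open>Since \<delta> is the threshold from absolute continuity, it applies to every
      division whose union lies in both \<open>U\<close> and \<open>{a..b}\<close>.\<close>
    obtain U where U: "open U" "N \<subseteq> U" "emeasure lebesgue (U - N) < ennreal \<delta>"
      using sets_lebesgue_outer_open[OF negligible_imp_sets[OF N] \<open>\<delta> > 0\<close>] by metis
    have "U \<in> sets lebesgue"
      using U(1) by (auto intro: borel_open)
    then have eU: "emeasure lebesgue U < ennreal \<delta>"
      using U(3) N by (simp add: negligible_iff_null_sets emeasure_Diff_null_set)
    then have mU: "U \<in> lmeasurable"
      using \<open>U \<in> sets lebesgue\<close> by (intro fmeasurableI) (auto intro: less_trans)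
    then have "measure lebesgue U < \<delta>"
      using eU \<open>\<delta> > 0\<close> by (simp add: emeasure_eq_measure2 ennreal_less_iff)
    \<comment> \<open>One radius serves both kinds of tags. A point outside both \<open>N\<close>
      and \<open>{a..b}\<close> imposes no condition, so any radius works there.\<close>
    have "\<exists>d>0. (x \<in> N \<longrightarrow> ball x d \<subseteq> U) \<and> (x \<in> {a..b} - N \<longrightarrow>
        (\<forall>y\<in>{a..b}. norm (y - x) < d \<longrightarrow> norm (f y - f x - (y - x) *\<^sub>R f' x) \<le> e * norm (y - x)))" for x
    proof (cases "x \<in> N")
      case True
      then show ?thesis using U by (meson DiffD2 open_contains_ball subsetD)
    next
      case False
      then show ?thesis
        using vecd[of x, unfolded has_vector_derivative_def has_derivative_within_alt] \<open>e > 0\<close>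
        by (cases "x \<in> {a..b}") (auto intro: zero_less_one)
    qed
    then obtain d where d: "\<And>x. 0 < d x" "\<And>x. x \<in> N \<Longrightarrow> ball x (d x) \<subseteq> U"
        "\<And>x y. \<lbrakk>x \<in> {a..b} - N; y \<in> {a..b}; norm (y - x) < d x\<rbrakk>
           \<Longrightarrow> norm (f y - f x - (y - x) *\<^sub>R f' x) \<le> e * norm (y - x)"
      by metis
    show "\<exists>\<gamma>. gauge \<gamma> \<and> (\<forall>p. p tagged_division_of {a..b} \<and> \<gamma> fine p \<longrightarrow>
            norm ((\<Sum>(x,K)\<in>p. measure lborel K *\<^sub>R g x) - (f b - f a)) < \<epsilon>)"
    proof (intro exI conjI allI impI; (elim conjE)?)
      show "gauge (\<lambda>x. ball x (d x))"
        using d(1) gauge_ball_dependent by blast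
    next
      fix p assume p: "p tagged_division_of {a..b}" and fine: "(\<lambda>x. ball x (d x)) fine p"
      have "finite p" using p by blast
      define q where "q = {(x,K) \<in> p. x \<in> N}"
      have "q \<subseteq> p" by (auto simp: q_def)
      have pK: "\<exists>u v. K = {u..v} \<and> u \<le> x \<and> x \<le> v \<and> {u..v} \<subseteq> {a..b} \<and> {u..v} \<subseteq> ball x (d x)"
        if xK: "(x, K) \<in> p" for x K
      proof -
        obtain u v where "K = cbox u v" using tagged_division_ofD(4)[OF p xK] by blast
        moreover have "x \<in> K" "K \<subseteq> {a..b}" "K \<subseteq> ball x (d x)"
          using tagged_division_ofD(2,3)[OF p xK] fineD[OF fine xK] by auto
        ultimately show ?thesis by auto
      qed
      have "q tagged_partial_division_of {a..b}"
        using p tagged_partial_division_subset[OF _ \<open>q \<subseteq> p\<close>] by (simp add: tagged_division_of_def)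
      then have qU: "q tagged_division_of \<Union>(snd ` q)"
        by (rule tagged_partial_division_of_Union_self)
      \<comment> \<open>Absolute continuity speaks of sets of intervals, so the tags are
        dropped.\<close>
      define D where "D = snd ` q"
      have D: "D division_of \<Union>D"
        unfolding D_def by (rule division_of_tagged_division[OF qU])
      have DU: "\<Union>D \<subseteq> U" "\<Union>D \<subseteq> {a..b}"
        using pK d(2) by (fastforce simp: D_def q_def)+
      have "(\<Sum>K\<in>D. Sup K - Inf K) = (\<Sum>K\<in>D. measure lebesgue K)"
        using pK by (intro sum.cong) (fastforce simp: D_def q_def)+
      also have "\<dots> = measure lebesgue (\<Union>D)"
        by (rule content_division[OF D])
      also have "\<dots> \<le> measure lebesgue U"
        using DU(1) mU D by (intro measure_mono_fmeasurable) (auto intro: fmeasurableD lmeasurable_division)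
      finally have "(\<Sum>K\<in>D. Sup K - Inf K) < \<delta>"
        using \<open>measure lebesgue U < \<delta>\<close> by simp
      from \<delta>[OF D DU(2) this] have "(\<Sum>K\<in>D. norm (f (Sup K) - f (Inf K))) < e" .
      \<comment> \<open>Nothing is lost by dropping tags: an interval carrying two different tags
        has empty interior, so it is a single point and the increment of \<open>f\<close> over it is
        zero.\<close>
      moreover have "(\<Sum>(x,K)\<in>q. norm (f (Sup K) - f (Inf K))) = (\<Sum>K\<in>D. norm (f (Sup K) - f (Inf K)))"
        unfolding D_def
      proof (subst sum.reindex_nontrivial)
        show "finite q" using \<open>q \<subseteq> p\<close> \<open>finite p\<close> finite_subset by blast
      next
        fix z z' assume z: "z \<in> q" "z' \<in> q" "z \<noteq> z'" "snd z = snd z'"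
        obtain x x' K where xK: "z = (x, K)" "z' = (x', K)" "x \<noteq> x'"
          using z(3,4) by (metis prod.collapse)
        then have "interior K = {}"
          using tagged_division_ofD(5)[OF qU, of x K x' K] z by auto
        moreover obtain u v where "K = {u..v}" "u \<le> v"
          using pK[of x K] z(1) xK(1) \<open>q \<subseteq> p\<close> by fastforce
        ultimately show "norm (f (Sup (snd z)) - f (Inf (snd z))) = 0"
          using xK by (simp add: interior_atLeastAtMost_real)
      qed (simp add: split_def)
      ultimately have q: "(\<Sum>(x,K)\<in>q. norm (f (Sup K) - f (Inf K))) < e" by simp
      have ba: "b - a = (\<Sum>(x,K)\<in>p. Sup K - Inf K)" "f b - f a = (\<Sum>(x,K)\<in>p. f (Sup K) - f (Inf K))"
        using additive_tagged_division_1[where f= "\<lambda>x. x"] additive_tagged_division_1[where f= f]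
              \<open>a \<le> b\<close> p by auto
      have "norm (\<Sum>(x,K)\<in>p - q. measure lborel K *\<^sub>R g x - (f (Sup K) - f (Inf K)))
          \<le> (\<Sum>(x,K)\<in>p - q. e * (Sup K - Inf K))"
      proof (rule sum_norm_le, clarify)
        fix x K assume xK: "(x, K) \<in> p" "(x, K) \<notin> q"
        then have "x \<notin> N" by (auto simp: q_def)
        obtain u v where K: "K = {u..v}" "u \<le> x" "x \<le> v" "{u..v} \<subseteq> {a..b}" "{u..v} \<subseteq> ball x (d x)"
          using pK[OF xK(1)] by blast
        have "u \<in> {u..v}" "v \<in> {u..v}" "x \<in> {u..v}" using K by auto
        then have in_ab: "x \<in> {a..b} - N" "u \<in> {a..b}" "v \<in> {a..b}"
          and "u \<in> ball x (d x)" "v \<in> ball x (d x)"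
          using K(4,5) \<open>x \<notin> N\<close> by blast+
        then have dist_less: "norm (u - x) < d x" "norm (v - x) < d x"
          by (simp_all add: dist_norm norm_minus_commute)
        \<comment> \<open>Splitting at the tag writes the error as a difference of two first-order
          remainders based at \<open>x\<close>. As \<open>u \<le> x \<le> v\<close>, their bounds
          add up to \<open>e * (v - u)\<close>.\<close>
        have "norm (measure lborel K *\<^sub>R g x - (f (Sup K) - f (Inf K)))
            = norm ((f u - f x - (u - x) *\<^sub>R f' x) - (f v - f x - (v - x) *\<^sub>R f' x))"
          using K(1-3) \<open>x \<notin> N\<close> by (simp add: g_def algebra_simps)
        also have "\<dots> \<le> e * norm (u - x) + e * norm (v - x)"
          using in_ab dist_less
          by (intro order_trans[OF norm_triangle_ineq4] add_mono d(3)) auto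
        also have "\<dots> = e * (Sup K - Inf K)"
          using K(1-3) by (simp add: algebra_simps)
        finally show "norm (measure lborel K *\<^sub>R g x - (f (Sup K) - f (Inf K))) \<le> e * (Sup K - Inf K)" .
      qed
      also have "\<dots> \<le> (\<Sum>(x,K)\<in>p. e * (Sup K - Inf K))"
        using \<open>finite p\<close> \<open>e > 0\<close> pK by (intro sum_mono2) fastforce+
      also have "\<dots> = e * (b - a)"
        by (simp add: ba(1) sum_distrib_left split_def)
      finally have pq: "norm (\<Sum>(x,K)\<in>p - q. measure lborel K *\<^sub>R g x - (f (Sup K) - f (Inf K))) \<le> e * (b - a)" .
      \<comment> \<open>Here \<open>g\<close> vanishes at every tag, so only the increments of
        \<open>f\<close> remain.\<close>
      have "norm (\<Sum>(x,K)\<in>q. measure lborel K *\<^sub>R g x - (f (Sup K) - f (Inf K)))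
          \<le> (\<Sum>(x,K)\<in>q. norm (f (Sup K) - f (Inf K)))"
        by (rule sum_norm_le) (auto simp: q_def g_def norm_minus_commute)
      with q pq have "norm ((\<Sum>(x,K)\<in>p - q. measure lborel K *\<^sub>R g x - (f (Sup K) - f (Inf K)))
          + (\<Sum>(x,K)\<in>q. measure lborel K *\<^sub>R g x - (f (Sup K) - f (Inf K)))) < \<epsilon>"
        unfolding e[symmetric] by (smt (verit) norm_triangle_ineq)
      then have "norm (\<Sum>(x,K)\<in>p. measure lborel K *\<^sub>R g x - (f (Sup K) - f (Inf K))) < \<epsilon>"
        by (simp only: sum.subset_diff[OF \<open>q \<subseteq> p\<close> \<open>finite p\<close>])
      then show "norm ((\<Sum>(x,K)\<in>p. measure lborel K *\<^sub>R g x) - (f b - f a)) < \<epsilon>"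
        by (simp add: ba(2) split_def sum_subtractf)
    qed
  qed
  then show ?thesis
    by (rule has_integral_spike[OF N, rotated]) (auto simp: g_def)
qed

section \<open>Closure properties of absolute continuity\<close>

lemma division_of_Icc_memE:
  fixes K :: "real set"
  assumes "D division_of \<Union>D" "\<Union>D \<subseteq> {a..b}" "K \<in> D"
  obtains u v where "K = {u..v}" "u \<le> v" "u \<in> {a..b}" "v \<in> {a..b}"
proof -
  obtain u v where K: "K = cbox u v" "K \<noteq> {}"
    using division_ofD(3,4)[OF assms(1,3)] by blast
  moreover from K have "u \<le> v" by simp
  ultimately show ?thesis
    using that[of u v] assms(2,3) by (simp, metis UnionI atLeastAtMost_iff order_refl subsetD)
qed

lemma lipschitz_imp_abs_continuous:
  fixes f :: "real \<Rightarrow> 'a::real_normed_vector"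
  assumes f: "L-lipschitz_on {a..b} f"
  shows "abs_continuous_on_interval a b f"
  unfolding abs_continuous_on_interval_def
proof (intro allI impI)
  fix \<epsilon> :: real assume "\<epsilon> > 0"
  have "L \<ge> 0" using f lipschitz_on_nonneg by blast
  show "\<exists>\<delta>>0. \<forall>D. D division_of \<Union>D \<longrightarrow> \<Union>D \<subseteq> {a..b} \<longrightarrow>
      (\<Sum>K\<in>D. Sup K - Inf K) < \<delta> \<longrightarrow> (\<Sum>K\<in>D. norm (f (Sup K) - f (Inf K))) < \<epsilon>"
  \<comment> \<open>Dividing by \<open>L + 1\<close> instead of \<open>L\<close> covers the case
    \<open>L = 0\<close>.\<close>
  proof (intro exI[of _ "\<epsilon> / (L + 1)"] conjI allI impI)
    show "\<epsilon> / (L + 1) > 0" using \<open>\<epsilon> > 0\<close> \<open>L \<ge> 0\<close> by simp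
  next
    fix D :: "real set set"
    assume D: "D division_of \<Union>D" "\<Union>D \<subseteq> {a..b}" and less: "(\<Sum>K\<in>D. Sup K - Inf K) < \<epsilon> / (L + 1)"
    have "(\<Sum>K\<in>D. norm (f (Sup K) - f (Inf K))) \<le> (\<Sum>K\<in>D. (L + 1) * (Sup K - Inf K))"
    proof (rule sum_mono)
      fix K assume "K \<in> D"
      then obtain u v where K: "K = {u..v}" "u \<le> v" "u \<in> {a..b}" "v \<in> {a..b}"
        using division_of_Icc_memE[OF D] by blast
      have "norm (f v - f u) \<le> L * (v - u)"
        using lipschitz_onD[OF f K(4,3)] K(2) by (simp add: dist_norm)
      also have "\<dots> \<le> (L + 1) * (v - u)"
        using K(2) by (simp add: algebra_simps)
      finally show "norm (f (Sup K) - f (Inf K)) \<le> (L + 1) * (Sup K - Inf K)"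
        using K by simp
    qed
    also have "\<dots> = (L + 1) * (\<Sum>K\<in>D. Sup K - Inf K)"
      by (simp add: sum_distrib_left)
    also have "\<dots> < \<epsilon>"
      using less \<open>L \<ge> 0\<close> by (simp add: field_simps)
    finally show "(\<Sum>K\<in>D. norm (f (Sup K) - f (Inf K))) < \<epsilon>" .
  qed
qed

text \<open>Continuity is the case of a division with a single member, the interval between two
  nearby points.\<close>

lemma abs_continuous_imp_continuous_on:
  fixes f :: "real \<Rightarrow> 'a::real_normed_vector"
  assumes f: "abs_continuous_on_interval a b f"
  shows "continuous_on {a..b} f"
  unfolding continuous_on_iff
proof (intro ballI allI impI)
  fix x \<epsilon> :: real assume x: "x \<in> {a..b}" and "\<epsilon> > 0"
  then obtain \<delta> where "\<delta> > 0" and \<delta>: "\<And>D. \<lbrakk>D division_of \<Union>D; \<Union>D \<subseteq> {a..b}; (\<Sum>K\<in>D. Sup K - Inf K) < \<delta>\<rbrakk>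
        \<Longrightarrow> (\<Sum>K\<in>D. norm (f (Sup K) - f (Inf K))) < \<epsilon>"
    using abs_continuousE[OF f] by blast
  have *: "norm (f v - f u) < \<epsilon>" if "u \<in> {a..b}" "v \<in> {a..b}" "u \<le> v" "v - u < \<delta>" for u v
    using \<delta>[of "{{u..v}}"] that division_of_self[of u v] by auto
  show "\<exists>d>0. \<forall>y\<in>{a..b}. dist y x < d \<longrightarrow> dist (f y) (f x) < \<epsilon>"
  proof (intro exI[of _ \<delta>] conjI ballI impI \<open>\<delta> > 0\<close>)
    fix y assume "y \<in> {a..b}" "dist y x < \<delta>"
    then show "dist (f y) (f x) < \<epsilon>"
      using *[of x y] *[of y x] x by (cases "x \<le> y") (auto simp: dist_norm norm_minus_commute)
  qed
qed

text \<open>Both factors are bounded on the compact interval. An increment of the product splits as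
  in the product rule, so each increment of one factor is weighted by the bound of the other; this
  explains the tolerances \<open>\<epsilon> / (2 * M')\<close> and
  \<open>\<epsilon> / (2 * M)\<close>.\<close>

lemma abs_continuous_mult:
  fixes f g :: "real \<Rightarrow> 'a::real_normed_algebra"
  assumes f: "abs_continuous_on_interval a b f" and g: "abs_continuous_on_interval a b g"
  shows "abs_continuous_on_interval a b (\<lambda>x. f x * g x)"
  unfolding abs_continuous_on_interval_def
proof (intro allI impI)
  fix \<epsilon> :: real assume "\<epsilon> > 0"
  have "bounded (f ` {a..b})" "bounded (g ` {a..b})"
    using f g by (auto intro!: compact_imp_bounded compact_continuous_image abs_continuous_imp_continuous_on)
  then obtain M M' where "M > 0" and "M' > 0"
    and M: "\<And>x. x \<in> {a..b} \<Longrightarrow> norm (f x) \<le> M" and M': "\<And>x. x \<in> {a..b} \<Longrightarrow> norm (g x) \<le> M'"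
    unfolding bounded_pos by blast
  obtain \<delta> where "\<delta> > 0" and \<delta>: "\<And>D. \<lbrakk>D division_of \<Union>D; \<Union>D \<subseteq> {a..b}; (\<Sum>K\<in>D. Sup K - Inf K) < \<delta>\<rbrakk>
        \<Longrightarrow> (\<Sum>K\<in>D. norm (f (Sup K) - f (Inf K))) < \<epsilon> / (2 * M')"
    by (rule abs_continuousE[OF f, of "\<epsilon> / (2 * M')"]) (use \<open>\<epsilon> > 0\<close> \<open>M' > 0\<close> in auto)
  obtain \<delta>' where "\<delta>' > 0" and \<delta>': "\<And>D. \<lbrakk>D division_of \<Union>D; \<Union>D \<subseteq> {a..b}; (\<Sum>K\<in>D. Sup K - Inf K) < \<delta>'\<rbrakk>
        \<Longrightarrow> (\<Sum>K\<in>D. norm (g (Sup K) - g (Inf K))) < \<epsilon> / (2 * M)"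
    by (rule abs_continuousE[OF g, of "\<epsilon> / (2 * M)"]) (use \<open>\<epsilon> > 0\<close> \<open>M > 0\<close> in auto)
  show "\<exists>\<delta>>0. \<forall>D. D division_of \<Union>D \<longrightarrow> \<Union>D \<subseteq> {a..b} \<longrightarrow> (\<Sum>K\<in>D. Sup K - Inf K) < \<delta> \<longrightarrow>
      (\<Sum>K\<in>D. norm (f (Sup K) * g (Sup K) - f (Inf K) * g (Inf K))) < \<epsilon>"
  proof (intro exI[of _ "min \<delta> \<delta>'"] conjI allI impI)
    show "min \<delta> \<delta>' > 0" using \<open>\<delta> > 0\<close> \<open>\<delta>' > 0\<close> by simp
  next
    fix D :: "real set set"
    assume D: "D division_of \<Union>D" "\<Union>D \<subseteq> {a..b}" and less: "(\<Sum>K\<in>D. Sup K - Inf K) < min \<delta> \<delta>'"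
    have "(\<Sum>K\<in>D. norm (f (Sup K) * g (Sup K) - f (Inf K) * g (Inf K)))
        \<le> (\<Sum>K\<in>D. M * norm (g (Sup K) - g (Inf K)) + M' * norm (f (Sup K) - f (Inf K)))"
    proof (rule sum_mono)
      fix K assume "K \<in> D"
      then obtain u v where K: "K = {u..v}" "u \<le> v" "u \<in> {a..b}" "v \<in> {a..b}"
        using division_of_Icc_memE[OF D] by blast
      have "norm (f v * g v - f u * g u) = norm (f v * (g v - g u) + (f v - f u) * g u)"
        by (simp add: algebra_simps)
      also have "\<dots> \<le> norm (f v) * norm (g v - g u) + norm (f v - f u) * norm (g u)"
        by (intro norm_triangle_le add_mono norm_mult_ineq)
      also have "\<dots> \<le> M * norm (g v - g u) + norm (f v - f u) * M'"
        using M[OF K(4)] M'[OF K(3)] by (intro add_mono mult_right_mono mult_left_mono) auto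
      finally show "norm (f (Sup K) * g (Sup K) - f (Inf K) * g (Inf K))
          \<le> M * norm (g (Sup K) - g (Inf K)) + M' * norm (f (Sup K) - f (Inf K))"
        using K by (simp add: mult.commute)
    qed
    also have "\<dots> = M * (\<Sum>K\<in>D. norm (g (Sup K) - g (Inf K))) + M' * (\<Sum>K\<in>D. norm (f (Sup K) - f (Inf K)))"
      by (simp add: sum.distrib sum_distrib_left)
    also have "\<dots> < M * (\<epsilon> / (2 * M)) + M' * (\<epsilon> / (2 * M'))"
      using \<delta>[OF D] \<delta>'[OF D] less \<open>M > 0\<close> \<open>M' > 0\<close> by (intro add_strict_mono mult_strict_left_mono) auto
    also have "\<dots> = \<epsilon>" using \<open>M > 0\<close> \<open>M' > 0\<close> by simp
    finally show "(\<Sum>K\<in>D. norm (f (Sup K) * g (Sup K) - f (Inf K) * g (Inf K))) < \<epsilon>" .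
  qed
qed

section \<open>Calculus of the oscillating weight\<close>

lemma osc_weight_has_vector_derivative:
  "(osc_weight k has_vector_derivative - 2 * of_real pi * \<i> * of_int k * osc_weight k x) (at x within S)"
proof -
  let ?c = "- 2 * of_real pi * \<i> * of_int k :: complex"
  have "((\<lambda>z. exp (?c * z)) has_field_derivative ?c * exp (?c * of_real x)) (at (of_real x))"
    by (auto intro!: derivative_eq_intros)
  from has_vector_derivative_real_field[OF this] show ?thesis
    unfolding osc_weight_def by (rule has_vector_derivative_at_within)
qed

lemma norm_osc_weight [simp]: "norm (osc_weight k x) = 1"
  by (simp add: osc_weight_def norm_exp_eq_Re)

text \<open>Negating the frequency gives the reciprocal, which for a unimodular function is the
  complex conjugate.\<close>

lemma osc_weight_uminus_mult: "osc_weight (- k) x * osc_weight k x = 1"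
  by (simp add: osc_weight_def flip: exp_add)

lemma osc_weight_0 [simp]: "osc_weight k 0 = 1"
  by (simp add: osc_weight_def)

lemma osc_weight_1 [simp]: "osc_weight k 1 = 1"
  using exp_integer_2pi[of "- of_int k"] by (simp add: osc_weight_def mult_ac)

lemma lipschitz_on_osc_weight: "(2 * pi * \<bar>of_int k\<bar>)-lipschitz_on {a..b} (osc_weight k)"
proof (rule bounded_derivative_imp_lipschitz)
  show "(osc_weight k has_derivative (\<lambda>h. h *\<^sub>R (- 2 * of_real pi * \<i> * of_int k * osc_weight k x)))
      (at x within {a..b})" for x
    using osc_weight_has_vector_derivative by (simp only: has_vector_derivative_def)
  show "onorm (\<lambda>h. h *\<^sub>R (- 2 * of_real pi * \<i> * of_int k * osc_weight k x)) \<le> 2 * pi * \<bar>of_int k\<bar>" for x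
    by (rule onorm_bound) (auto simp: norm_mult)
qed auto

lemma abs_continuous_osc_weight: "abs_continuous_on_interval a b (osc_weight k)"
  using lipschitz_on_osc_weight by (rule lipschitz_imp_abs_continuous)

text \<open>Expressing the extremal function through the weight of opposite frequency reduces its
  calculus to that of the weights.\<close>

lemma extremal_fun_eq:
  "extremal_fun k x = of_real (1 / (2 * pi * \<bar>of_int k\<bar>)) * (osc_weight (- k) x - 1)"
  by (simp add: extremal_fun_def osc_weight_def)

text \<open>The weight is a nonzero multiple of its own derivative, and it takes the same value at
  both endpoints because \<open>k\<close> is an integer.\<close>

lemma lebesgue_integral_osc_weight:
  assumes "k \<noteq> 0"
  shows "(LINT x|lebesgue_on {0..1}. osc_weight k x) = 0"
proof -
  let ?c = "- 2 * of_real pi * \<i> * of_int k :: complex"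
  have "integrable (lebesgue_on {0..1}) (\<lambda>x. ?c * osc_weight k x)"
    by (intro integrable_mult_right continuous_imp_integrable_real
        abs_continuous_imp_continuous_on abs_continuous_osc_weight)
  then have "((\<lambda>x. ?c * osc_weight k x) has_integral (LINT x|lebesgue_on {0..1}. ?c * osc_weight k x)) {0..1}"
    by (rule has_integral_integral_lebesgue_on) simp
  moreover have "((\<lambda>x. ?c * osc_weight k x) has_integral (osc_weight k 1 - osc_weight k 0)) {0..1}"
    by (rule fundamental_theorem_of_calculus[OF zero_le_one osc_weight_has_vector_derivative])
  ultimately have "(LINT x|lebesgue_on {0..1}. ?c * osc_weight k x) = osc_weight k 1 - osc_weight k 0"
    by (rule has_integral_unique)
  then show ?thesis using assms by simp
qed

section \<open>Square-integrable functions on the unit interval\<close>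

text \<open>The interval has finite measure, and expanding
  \<open>(norm (g x) - 1)\<^sup>2 \<ge> 0\<close> gives an integrable majorant.\<close>

lemma L2_unit_imp_integrable:
  assumes "g \<in> L2_unit"
  shows "integrable (lebesgue_on {0..1}) g"
proof (rule measurable_bounded_by_integrable_imp_lebesgue_integrable)
  show "g \<in> borel_measurable (lebesgue_on {0..1})"
    using assms by (simp add: L2_unit_def)
  show "integrable (lebesgue_on {0..1}) (\<lambda>x. (1 + (norm (g x))\<^sup>2) / 2)"
    using assms by (auto simp: L2_unit_def intro!: continuous_imp_integrable_real)
  show "norm (g x) \<le> (1 + (norm (g x))\<^sup>2) / 2" for x
    using zero_le_power2[of "norm (g x) - 1"] by (simp add: power2_eq_square algebra_simps)
qed simp

text \<open>
  The weakened form of the Cauchy--Schwarz inequality obtained from AM-GM; the two agree when the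
  norm is \<open>1\<close>.
\<close>

lemma L2_unit_integral_norm_le:
  assumes "g \<in> L2_unit"
  shows "(LINT x|lebesgue_on {0..1}. norm (g x)) \<le> (1 + (L2_unit_norm g)\<^sup>2) / 2"
proof -
  have "norm (g x) \<le> (1 + (norm (g x))\<^sup>2) / 2" for x
    using zero_le_power2[of "norm (g x) - 1"] by (simp add: power2_eq_square algebra_simps)
  then have "(LINT x|lebesgue_on {0..1}. norm (g x)) \<le> (LINT x|lebesgue_on {0..1}. (1 + (norm (g x))\<^sup>2) / 2)"
    using assms L2_unit_imp_integrable[OF assms]
    by (intro integral_mono integrable_norm) (auto simp: L2_unit_def intro!: continuous_imp_integrable_real)
  also have "\<dots> = (1 + (LINT x|lebesgue_on {0..1}. (norm (g x))\<^sup>2)) / 2"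
    using assms by (simp add: L2_unit_def continuous_imp_integrable_real measure_restrict_space)
  also have "(LINT x|lebesgue_on {0..1}. (norm (g x))\<^sup>2) = (L2_unit_norm g)\<^sup>2"
    by (simp add: L2_unit_norm_def)
  finally show ?thesis .
qed

section \<open>The upper bound\<close>

text \<open>Integration by parts without boundary terms, obtained by applying the fundamental
  theorem to the product of \<open>f\<close> and the weight. This tolerates a derivative that exists
  only almost everywhere.\<close>

lemma osc_weighted_integral_by_parts:
  assumes "f \<in> H10"
  shows "2 * of_real pi * \<i> * of_int k * weighted_integral (osc_weight k) f
      = weighted_integral (osc_weight k) (deriv_unit f)"
proof -
  let ?c = "2 * of_real pi * \<i> * of_int k :: complex" and ?w = "osc_weight k"
  have ac: "abs_continuous_on_interval 0 1 f"
    and ae: "AE x in lebesgue_on {0..1}. f differentiable (at x within {0..1})"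
    and L2: "deriv_unit f \<in> L2_unit" and bd: "f 0 = 0" "f 1 = 0"
    using assms by (auto simp: H10_def)
  have cont: "continuous_on {0..1} f" "continuous_on {0..1} ?w"
    using ac abs_continuous_osc_weight by (auto intro: abs_continuous_imp_continuous_on)
  have i1: "integrable (lebesgue_on {0..1}) (\<lambda>x. f x * ?w x)"
    using cont by (intro continuous_imp_integrable_real continuous_intros)
  have "?w \<in> borel_measurable (lebesgue_on {0..1})"
    using cont(2) by (rule continuous_imp_measurable_on_sets_lebesgue) simp
  \<comment> \<open>Multiplication by a unimodular function preserves the modulus, so the derivative
    itself is the majorant.\<close>
  then have i2: "integrable (lebesgue_on {0..1}) (\<lambda>x. deriv_unit f x * ?w x)"
    using L2_unit_imp_integrable[OF L2]
    by (intro Bochner_Integration.integrable_bound[OF L2_unit_imp_integrable[OF L2]]) (auto simp: norm_mult)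
  have "AE x in lebesgue. x \<in> {0..1} \<longrightarrow> f differentiable (at x within {0..1})"
    using ae by (simp add: AE_restrict_space_iff)
  then obtain N where "negligible N" and N: "\<And>x. x \<in> {0..1} - N \<Longrightarrow> f differentiable (at x within {0..1})"
    unfolding eventually_ae_filter_negligible by blast
  have "((\<lambda>x. f x * ?w x) has_vector_derivative f x * (- ?c * ?w x) + deriv_unit f x * ?w x) (at x within {0..1})"
    if "x \<in> {0..1} - N" for x
    using N[OF that] osc_weight_has_vector_derivative[of k x]
    by (intro has_vector_derivative_mult) (auto simp: deriv_unit_def vector_derivative_works[symmetric])
  from has_integral_abs_continuous[OF zero_le_one abs_continuous_mult[OF ac abs_continuous_osc_weight] \<open>negligible N\<close> this]
  have "((\<lambda>x. f x * (- ?c * ?w x) + deriv_unit f x * ?w x) has_integral 0) {0..1}"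
    using bd by simp
  \<comment> \<open>The fundamental theorem yields a gauge integral, while
    \<open>weighted_integral\<close> is a Lebesgue integral. Integrability of both summands
    identifies the two values.\<close>
  moreover have "((\<lambda>x. - ?c * (f x * ?w x) + deriv_unit f x * ?w x) has_integral
      (LINT x|lebesgue_on {0..1}. - ?c * (f x * ?w x) + deriv_unit f x * ?w x)) {0..1}"
    using i1 i2 by (intro has_integral_integral_lebesgue_on Bochner_Integration.integrable_add integrable_mult_right) auto
  ultimately have "(LINT x|lebesgue_on {0..1}. - ?c * (f x * ?w x) + deriv_unit f x * ?w x) = 0"
    by (auto simp: mult_ac dest: has_integral_unique)
  moreover have "(LINT x|lebesgue_on {0..1}. - ?c * (f x * ?w x) + deriv_unit f x * ?w x)
      = - ?c * weighted_integral ?w f + weighted_integral ?w (deriv_unit f)"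
    unfolding weighted_integral_def using i1 i2
    by (subst Bochner_Integration.integral_add) (auto simp del: mult_minus_left)
  ultimately show ?thesis by simp
qed

text \<open>Taking moduli in the integration by parts removes the weight and leaves the integral of
  the modulus of the derivative.\<close>

lemma osc_weighted_integral_le:
  assumes f: "f \<in> H10" "H10_norm f \<le> 1" and "k \<noteq> 0"
  shows "norm (weighted_integral (osc_weight k) f) \<le> 1 / (2 * pi * \<bar>of_int k\<bar>)"
proof -
  let ?w = "osc_weight k"
  have L2: "deriv_unit f \<in> L2_unit" using f by (simp add: H10_def)
  have "2 * pi * \<bar>of_int k\<bar> * norm (weighted_integral ?w f)
      = norm (2 * of_real pi * \<i> * of_int k * weighted_integral ?w f)"
    by (simp add: norm_mult)
  also have "\<dots> = norm (weighted_integral ?w (deriv_unit f))"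
    by (simp only: osc_weighted_integral_by_parts[OF f(1)])
  also have "\<dots> \<le> (LINT x|lebesgue_on {0..1}. norm (deriv_unit f x * ?w x))"
    unfolding weighted_integral_def by (rule integral_norm_bound)
  also have "\<dots> = (LINT x|lebesgue_on {0..1}. norm (deriv_unit f x))"
    by (simp add: norm_mult)
  also have "\<dots> \<le> (1 + (L2_unit_norm (deriv_unit f))\<^sup>2) / 2"
    by (rule L2_unit_integral_norm_le[OF L2])
  also have "\<dots> \<le> 1"
    using f(2) by (simp add: H10_norm_def L2_unit_norm_def power_le_one)
  finally show ?thesis
    using \<open>k \<noteq> 0\<close> by (simp add: field_simps)
qed

section \<open>The extremal function\<close>

text \<open>Differentiation produces the factor \<open>k\<close>, while the normalisation divides by
  its absolute value, so only the sign of \<open>k\<close> survives.\<close>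

lemma extremal_fun_has_vector_derivative:
  assumes "k \<noteq> 0"
  shows "(extremal_fun k has_vector_derivative of_int (sgn k) * \<i> * osc_weight (- k) x) (at x within S)"
proof -
  have "((\<lambda>x. of_real (1 / (2 * pi * \<bar>of_int k\<bar>)) * (osc_weight (- k) x - 1)) has_vector_derivative
      of_real (1 / (2 * pi * \<bar>of_int k\<bar>)) * (- 2 * of_real pi * \<i> * of_int (- k) * osc_weight (- k) x - 0))
      (at x within S)"
    by (intro has_vector_derivative_mult_right has_vector_derivative_diff
        osc_weight_has_vector_derivative has_vector_derivative_const)
  moreover have "of_real (1 / (2 * pi * \<bar>of_int k\<bar>)) * (- 2 * of_real pi * \<i> * of_int (- k) * osc_weight (- k) x - 0)
      = of_int (sgn k) * \<i> * osc_weight (- k) x"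
    using assms by (cases "k > 0") (auto simp: field_simps)
  ultimately show ?thesis
    by (simp add: extremal_fun_eq[abs_def])
qed

lemma extremal_fun_0 [simp]: "extremal_fun k 0 = 0" and extremal_fun_1 [simp]: "extremal_fun k 1 = 0"
  by (simp_all add: extremal_fun_eq)

text \<open>The interval is nondegenerate, so derivatives within it are unique even at the
  endpoints.\<close>

lemma deriv_unit_extremal_fun:
  assumes "k \<noteq> 0" "x \<in> {0..1}"
  shows "deriv_unit (extremal_fun k) x = of_int (sgn k) * \<i> * osc_weight (- k) x"
  unfolding deriv_unit_def
  by (rule vector_derivative_within_closed_interval) (use assms extremal_fun_has_vector_derivative in auto)

text \<open>The derivative has modulus one throughout. This gives the Lipschitz constant
  \<open>1\<close>, hence absolute continuity, as well as square integrability and the norm.\<close>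

lemma extremal_fun_in_H10:
  assumes "k \<noteq> 0"
  shows "extremal_fun k \<in> H10" "H10_norm (extremal_fun k) = 1"
proof -
  let ?d = "\<lambda>x. of_int (sgn k) * \<i> * osc_weight (- k) x :: complex"
  have d: "deriv_unit (extremal_fun k) x = ?d x" if "x \<in> {0..1}" for x
    using deriv_unit_extremal_fun[OF assms that] .
  have "norm (of_int (sgn k) :: complex) = 1" 
    using assms by (cases "k > 0") auto
  then have n: "norm (deriv_unit (extremal_fun k) x) = 1" if "x \<in> {0..1}" for x
    using d[OF that] by (simp add: norm_mult)
  have "abs_continuous_on_interval 0 1 (extremal_fun k)"
  proof (rule lipschitz_imp_abs_continuous[OF bounded_derivative_imp_lipschitz])
    show "(extremal_fun k has_derivative (\<lambda>h. h *\<^sub>R ?d x)) (at x within {0..1})" for x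
      using extremal_fun_has_vector_derivative[OF assms] by (simp only: has_vector_derivative_def)
    show "onorm (\<lambda>h. h *\<^sub>R ?d x) \<le> 1" for x
      using \<open>norm (of_int (sgn k) :: complex) = 1\<close> by (intro onorm_bound) (auto simp: norm_mult)
  qed auto
  moreover have "extremal_fun k differentiable (at x within {0..1})" for x
    using extremal_fun_has_vector_derivative[OF assms] differentiableI_vector by blast
  moreover have "deriv_unit (extremal_fun k) \<in> borel_measurable (lebesgue_on {0..1})"
  proof (subst measurable_cong)
    show "?d \<in> borel_measurable (lebesgue_on {0..1})"
      by (intro continuous_imp_measurable_on_sets_lebesgue continuous_intros
          abs_continuous_imp_continuous_on abs_continuous_osc_weight) simp
  qed (use d in simp)
  moreover have "integrable (lebesgue_on {0..1}) (\<lambda>x. (norm (deriv_unit (extremal_fun k) x))\<^sup>2)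
      \<longleftrightarrow> integrable (lebesgue_on {0..1::real}) (\<lambda>x. 1 :: real)"
    using n by (intro Bochner_Integration.integrable_cong) auto
  moreover have "integrable (lebesgue_on {0..1::real}) (\<lambda>x. 1 :: real)"
    by (rule continuous_imp_integrable_real) simp
  ultimately show "extremal_fun k \<in> H10"
    by (simp add: H10_def L2_unit_def)
  have "(LINT x|lebesgue_on {0..1}. (norm (deriv_unit (extremal_fun k) x))\<^sup>2)
      = (LINT x|lebesgue_on {0..1::real}. 1)"
    using n by (intro Bochner_Integration.integral_cong) auto
  then show "H10_norm (extremal_fun k) = 1"
    by (simp add: H10_norm_def L2_unit_norm_def measure_restrict_space)
qed

text \<open>Multiplication by the weight cancels the oscillation of the exponential term and moves
  it to the constant term, whose integral then vanishes.\<close>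

lemma osc_weighted_integral_extremal_fun:
  assumes "k \<noteq> 0"
  shows "weighted_integral (osc_weight k) (extremal_fun k) = of_real (1 / (2 * pi * \<bar>of_int k\<bar>))"
proof -
  let ?c = "of_real (1 / (2 * pi * \<bar>of_int k\<bar>)) :: complex"
  have "integrable (lebesgue_on {0..1}) (osc_weight k)"
    by (intro continuous_imp_integrable_real abs_continuous_imp_continuous_on abs_continuous_osc_weight)
  moreover have "integrable (lebesgue_on {0..1::real}) (\<lambda>x. 1 :: complex)"
    by (rule continuous_imp_integrable_real) simp
  ultimately have "(LINT x|lebesgue_on {0..1}. ?c * (1 - osc_weight k x)) = ?c"
    using lebesgue_integral_osc_weight[OF assms]
    by (simp add: measure_restrict_space)
  moreover have "extremal_fun k x * osc_weight k x = ?c * (1 - osc_weight k x)" for x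
    using osc_weight_uminus_mult[of k x]
    unfolding extremal_fun_eq mult.assoc left_diff_distrib by (simp only: mult_1_left)
  ultimately show ?thesis by (simp add: weighted_integral_def)
qed

theorem proposition6:
  fixes k :: int
  assumes "k \<noteq> 0"
  shows "bdd_above (unit_ball_errors (weighted_integral (osc_weight k)))
    \<and> initial_error (weighted_integral (osc_weight k)) = 1 / (2 * pi * \<bar>real_of_int k\<bar>)
    \<and> extremal_fun k \<in> H10
    \<and> weighted_integral (osc_weight k) (extremal_fun k)
        = complex_of_real (initial_error (weighted_integral (osc_weight k)))
    \<and> H10_norm (extremal_fun k) = 1
    \<and> extremal_fun k 0 = 0
    \<and> extremal_fun k 1 = 0"
proof -
  let ?e = "1 / (2 * pi * \<bar>real_of_int k\<bar>)" and ?I = "weighted_integral (osc_weight k)"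
  have le: "y \<le> ?e" if "y \<in> unit_ball_errors ?I" for y
    using that osc_weighted_integral_le[OF _ _ assms] by (auto simp: unit_ball_errors_def)
  have "norm (?I (extremal_fun k)) = ?e"
    unfolding osc_weighted_integral_extremal_fun[OF assms] norm_of_real by simp
  \<comment> \<open>Membership makes the upper bound a maximum, and it shows that the set is
    nonempty, so its \<open>Sup\<close> is a genuine supremum.\<close>
  then have "?e \<in> unit_ball_errors ?I"
    unfolding unit_ball_errors_def using extremal_fun_in_H10[OF assms] by force
  then have "initial_error ?I = ?e"
    unfolding initial_error_def using le by (rule cSup_eq_maximum)
  then show ?thesis
    using le extremal_fun_in_H10[OF assms] osc_weighted_integral_extremal_fun[OF assms]
    by (auto intro!: bdd_aboveI[of _ ?e])
qed

end
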